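(* For all positive integers $n$ and $d$, $$\sum_{P \in \mathcal{H}(n)} \varphi(a_1)\,(d-1)^{\,r-\omega(P)}\, d^{\,\omega(P)} = d^n - 1,$$ where for each H-composition $P = [a_1 + \ldots + a_r = n]$ in $\mathcal{H}(n)$, $a_1$ is its first part, $r$ is its number of parts, $\omega(P)$ is its multiplicity, and $\varphi$ is Euler's totient function.
   Context: A composition of $n$ in $r$ parts is an ordered sequence $P=[a_1+\ldots+a_r=n]$ of positive integers $a_j$ with sum $n$ (the order of the parts matters). An H-composition is a composition satisfying $a_1 \geq a_j$ for all $j \leq r$. $\mathcal{H}(n)$ denotes the set of all H-compositions of $n$ (with any number of parts $r$). The multiplicity of $P\in\mathcal{H}(n)$ is the number of parts other than the first that are equal to the first: $\omega(P) = \#\{\, j>1 \mid a_j = a_1 \,\}$. *)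

theory Defs
  imports "HOL-Number_Theory.Totient"
begin

definition compositions :: "nat \<Rightarrow> nat list set" where
  "compositions n = {P. (\<forall>a \<in> set P. 0 < a) \<and> sum_list P = n}"

text \<open>
  List indices start at 0, so the first part \<open>a\<^sub>1\<close> of a composition \<open>P\<close> is \<open>P ! 0\<close>.
\<close>

definition H_compositions :: "nat \<Rightarrow> nat list set" where
  "H_compositions n = {P \<in> compositions n. \<forall>j < length P. P ! j \<le> P ! 0}"

definition multiplicity_H :: "nat list \<Rightarrow> nat" where
  "multiplicity_H P = card {j. 0 < j \<and> j < length P \<and> P ! j = P ! 0}"

text \<open>
  The index set of the sum is finite, and the exponent \<open>r - \<omega>(P)\<close> is a genuine
  (non-truncated) difference of natural numbers.
\<close>

lemma finite_H_compositions: "finite (H_compositions n)"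
proof (rule finite_subset)
  show "H_compositions n \<subseteq> {P. set P \<subseteq> {..n} \<and> length P \<le> n}"
  proof
    fix P assume "P \<in> H_compositions n"
    then have pos: "\<forall>a \<in> set P. 0 < a" and s: "sum_list P = n"
      by (auto simp: H_compositions_def compositions_def)
    have "length P \<le> sum_list P" using pos
      by (induction P) auto
    with s show "P \<in> {P. set P \<subseteq> {..n} \<and> length P \<le> n}"
      by (auto intro: member_le_sum_list)
  qed
  show "finite {P. set P \<subseteq> {..n} \<and> length P \<le> n}"
    by (rule finite_lists_length_le) simp
qed

lemma multiplicity_H_less_length:
  assumes "P \<noteq> []"
  shows "multiplicity_H P < length P"
proof -
  have "multiplicity_H P \<le> card {1..<length P}"
    unfolding multiplicity_H_def by (intro card_mono) auto
  with assms show ?thesis by (cases P) auto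
qed

end

theory Submission
  imports Defs "HOL-Computational_Algebra.Formal_Power_Series"
begin

text \<open>
  Sort the H-compositions by their first part \<open>m\<close>.  What follows \<open>m\<close> is an arbitrary word in the
  letters \<open>1, \<dots>, m\<close>, in which a letter \<open>a < m\<close> carries the weight \<open>d - 1\<close> and the letter \<open>m\<close>
  the weight \<open>d\<close>; the first part itself carries \<open>d - 1\<close>, since it is never counted by \<open>\<omega>\<close>.
  With \<open>p\<^sub>m = (d - 1) (x + \<dots> + x\<^sup>m\<^sup>-\<^sup>1) + d x\<^sup>m\<close> the H-compositions that start with \<open>m\<close> therefore
  have the generating function \<open>(d - 1) x\<^sup>m / (1 - p\<^sub>m)\<close>.

  The weights are made for the factorisation \<open>(1 - x) (1 - p\<^sub>m) = (1 - d x) (1 - x\<^sup>m)\<close>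
  (\<open>letters_fps_factorisation\<close>).  It turns the generating function into
  \<open>(d - 1) (1 - x) / (1 - d x)\<close>, which is free of \<open>m\<close>, times \<open>x\<^sup>m / (1 - x\<^sup>m)\<close>, the indicator
  series of the positive multiples of \<open>m\<close> (\<open>words_fps_multiples_fps\<close>).  Multiplying by \<open>\<phi>(m)\<close>
  and summing over \<open>m\<close> gives the Lambert series of \<open>\<phi>\<close>, whose \<open>n\<close>-th coefficient is
  \<open>\<Sum>\<^sub>m\<^sub>|\<^sub>n \<phi>(m) = n\<close>.  The factor \<open>1 - x\<close> takes the differences \<open>n - (n - 1) = 1\<close> of
  consecutive coefficients, and so the sum \<open>S(n)\<close> in question satisfies \<open>S(n) = d S(n - 1) + (d - 1)\<close> with
  \<open>S(0) = 0\<close>, which is the recurrence of \<open>d\<^sup>n - 1\<close>.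
\<close>

unbundle fps_syntax

section \<open>Weighted words\<close>

definition words :: "nat set \<Rightarrow> nat \<Rightarrow> nat list set" where
  "words A n = {Q. set Q \<subseteq> A \<and> sum_list Q = n}"

definition letters_fps :: "nat set \<Rightarrow> (nat \<Rightarrow> 'a) \<Rightarrow> 'a::comm_ring_1 fps" where
  "letters_fps A w = Abs_fps (\<lambda>a. if a \<in> A then w a else 0)"

definition words_fps :: "nat set \<Rightarrow> (nat \<Rightarrow> 'a) \<Rightarrow> 'a::comm_ring_1 fps" where
  "words_fps A w = Abs_fps (\<lambda>n. \<Sum>Q \<in> words A n. prod_list (map w Q))"

lemma words_0:
  assumes "0 \<notin> A"
  shows "words A 0 = {[]}"
proof -
  have "Q = []" if "set Q \<subseteq> A" "sum_list Q = 0" for Q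
    using that assms by (cases Q) auto
  then show ?thesis by (auto simp: words_def)
qed

lemma finite_words:
  assumes "0 \<notin> A"
  shows "finite (words A n)"
proof (rule finite_subset)
  show "words A n \<subseteq> {Q. set Q \<subseteq> {..n} \<and> length Q \<le> n}"
  proof
    fix Q assume Q: "Q \<in> words A n"
    have "set Q \<subseteq> A \<Longrightarrow> length Q \<le> sum_list Q"
    proof (induction Q)
      case (Cons a Q)
      then have "0 < a" using assms by (auto intro!: Nat.gr0I)
      with Cons show ?case by auto
    qed simp
    with Q show "Q \<in> {Q. set Q \<subseteq> {..n} \<and> length Q \<le> n}"
      by (auto simp: words_def intro: member_le_sum_list)
  qed
  show "finite {Q. set Q \<subseteq> {..n} \<and> length Q \<le> n}"
    by (rule finite_lists_length_le) simp
qed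

lemma words_first_letter:
  assumes "0 < n"
  shows "words A n = (\<Union>a \<in> {a \<in> A. a \<le> n}. Cons a ` words A (n - a))"
proof (rule set_eqI)
  fix Q
  show "Q \<in> words A n \<longleftrightarrow> Q \<in> (\<Union>a \<in> {a \<in> A. a \<le> n}. Cons a ` words A (n - a))"
    using assms by (cases Q) (auto simp: words_def)
qed

text \<open>A nonempty word is a letter followed by a word, that is \<open>F = 1 + p F\<close>.\<close>

lemma words_fps_inverse:
  assumes "0 \<notin> A"
  shows "words_fps A w * (1 - letters_fps A w) = 1"
proof -
  have "words_fps A w = 1 + letters_fps A w * words_fps A w"
  proof (rule fps_ext)
    fix n
    show "words_fps A w $ n = (1 + letters_fps A w * words_fps A w) $ n"
    proof (cases "n = 0")
      case True
      with assms show ?thesis by (simp add: words_fps_def letters_fps_def words_0)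
    next
      case False
      have "words_fps A w $ n =
          (\<Sum>Q \<in> (\<Union>a \<in> {a \<in> A. a \<le> n}. Cons a ` words A (n - a)). prod_list (map w Q))"
        using False by (simp add: words_fps_def words_first_letter)
      also have "\<dots> = (\<Sum>a \<in> {a \<in> A. a \<le> n}.
                        \<Sum>Q \<in> Cons a ` words A (n - a). prod_list (map w Q))"
        using assms by (intro sum.UNION_disjoint) (auto simp: finite_words)
      also have "\<dots> = (\<Sum>a \<in> {a \<in> A. a \<le> n}. w a * words_fps A w $ (n - a))"
        by (simp add: sum.reindex words_fps_def sum_distrib_left)
      also have "\<dots> = (\<Sum>a = 0..n. letters_fps A w $ a * words_fps A w $ (n - a))"
        by (rule sum.mono_neutral_cong_left) (auto simp: letters_fps_def)
      finally show ?thesis using False by (simp add: fps_mult_nth)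
    qed
  qed
  then show ?thesis by (simp add: algebra_simps)
qed

section \<open>Factorisation for the H-composition weights\<close>

definition H_weight :: "'a::comm_ring_1 \<Rightarrow> nat \<Rightarrow> nat \<Rightarrow> 'a" where
  "H_weight d m a = (if a = m then d else d - 1)"

text \<open>
  Split the weights into \<open>d - 1\<close> for every letter and an excess of \<open>1\<close> for the letter \<open>m\<close>.  Under
  the factor \<open>1 - x\<close> the first part telescopes to \<open>(d - 1) (x - x\<^sup>m\<^sup>+\<^sup>1)\<close>, the excess contributes
  \<open>x\<^sup>m - x\<^sup>m\<^sup>+\<^sup>1\<close>, and \<open>1 - x\<close> minus both is \<open>1 - d x - x\<^sup>m + d x\<^sup>m\<^sup>+\<^sup>1\<close>, which factors.
\<close>

lemma letters_fps_factorisation: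
  fixes d :: "'a::comm_ring_1"
  assumes "0 < m"
  shows "(1 - fps_X) * (1 - letters_fps {1..m} (H_weight d m)) =
         (1 - fps_const d * fps_X) * (1 - fps_X ^ m)"
proof -
  have "(1 - fps_X) * (1 - letters_fps {1..m} (H_weight d m)) =
      1 - letters_fps {1..m} (H_weight d m)
        - fps_X * (1 - letters_fps {1..m} (H_weight d m))"
    by (simp add: algebra_simps)
  also have "\<dots> = 1 - fps_const d * fps_X - fps_X ^ m + fps_const d * fps_X ^ Suc m"
  proof (rule fps_ext)
    fix n
    show "(1 - letters_fps {1..m} (H_weight d m)
        - fps_X * (1 - letters_fps {1..m} (H_weight d m))) $ n =
      (1 - fps_const d * fps_X - fps_X ^ m + fps_const d * fps_X ^ Suc m) $ n"
      using assms
      by (cases n) (auto simp: letters_fps_def H_weight_def fps_X_power_nth fps_X_nth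
          simp del: power_Suc)
  qed
  also have "\<dots> = (1 - fps_const d * fps_X) * (1 - fps_X ^ m)"
    by (simp add: algebra_simps)
  finally show ?thesis .
qed

definition multiples_fps :: "nat \<Rightarrow> 'a::comm_ring_1 fps" where
  "multiples_fps m = Abs_fps (\<lambda>n. of_bool (0 < n \<and> m dvd n))"

lemma multiples_fps_eq:
  assumes "0 < m"
  shows "multiples_fps m * (1 - fps_X ^ m) = fps_X ^ m"
proof -
  have "multiples_fps m = fps_X ^ m + fps_X ^ m * (multiples_fps m :: 'a fps)"
    using assms
    by (intro fps_ext)
      (auto simp: multiples_fps_def fps_X_power_mult_nth fps_X_power_nth
        dvd_imp_le not_less dvd_minus_self)
  then show ?thesis by (simp add: algebra_simps)
qed

text \<open>
  The left-hand side is, up to the constant \<open>d - 1\<close>, the generating function of the H-compositions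
  with first part \<open>m\<close>, freed of the denominator \<open>1 - d x\<close>.
\<close>

lemma words_fps_multiples_fps:
  fixes d :: "'a::idom"
  assumes "0 < m"
  shows "(1 - fps_const d * fps_X) * (fps_X ^ m * words_fps {1..m} (H_weight d m)) =
         (1 - fps_X) * multiples_fps m"
proof -
  let ?F = "words_fps {1..m} (H_weight d m)" and ?p = "letters_fps {1..m} (H_weight d m)"
  have "((1 - fps_const d * fps_X) * (fps_X ^ m * ?F)) * (1 - fps_X ^ m) =
      fps_X ^ m * ?F * ((1 - fps_const d * fps_X) * (1 - fps_X ^ m))"
    by (simp only: mult_ac)
  also have "\<dots> = fps_X ^ m * (1 - fps_X) * (?F * (1 - ?p))"
    unfolding letters_fps_factorisation[OF assms, symmetric] by (simp only: mult_ac)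
  also have "\<dots> = fps_X ^ m * (1 - fps_X)"
    by (simp add: words_fps_inverse)
  also have "\<dots> = ((1 - fps_X) * multiples_fps m) * (1 - fps_X ^ m)"
    unfolding mult.assoc multiples_fps_eq[OF assms] by (simp only: mult_ac)
  finally have "((1 - fps_const d * fps_X) * (fps_X ^ m * ?F)) * (1 - fps_X ^ m) =
      ((1 - fps_X) * multiples_fps m) * (1 - fps_X ^ m)" .
  moreover have "(1 - fps_X ^ m :: 'a fps) \<noteq> 0"
  proof
    assume "(1 - fps_X ^ m :: 'a fps) = 0"
    then have "(1 - fps_X ^ m :: 'a fps) $ 0 = 0" by simp
    with assms show False by (simp add: fps_X_power_nth)
  qed
  ultimately show ?thesis by simp
qed

section \<open>The Lambert series of the totient function\<close>

lemma sum_totient_multiples_fps: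
  assumes "n \<le> N"
  shows "(\<Sum>m = 1..N. of_nat (totient m) * multiples_fps m $ n) = (of_nat n :: 'a::comm_ring_1)"
proof (cases "n = 0")
  case False
  have divisor: "1 \<le> m \<and> m \<le> n" if "m dvd n" for m
    using False that dvd_imp_le[OF that] dvd_pos_nat[OF _ that] by (simp add: Suc_le_eq)
  have "(\<Sum>m = 1..N. of_nat (totient m) * multiples_fps m $ n) =
      (\<Sum>m | m dvd n. of_nat (totient m) :: 'a)"
    using assms False
    by (intro sum.mono_neutral_cong_right)
      (auto simp: multiples_fps_def dest: divisor)
  also have "\<dots> = of_nat n"
    by (simp only: totient_divisor_sum flip: of_nat_sum)
  finally show ?thesis .
qed (simp add: multiples_fps_def)

text \<open>
  Only the first parts \<open>m \<le> N\<close> are kept, so that the sum over \<open>m\<close> is finite; the coefficients up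
  to \<open>N\<close> are not affected, because a first part cannot exceed the sum.
\<close>

definition H_fps :: "nat \<Rightarrow> 'a::comm_ring_1 \<Rightarrow> 'a fps" where
  "H_fps N d = (\<Sum>m = 1..N. of_nat (totient m) *
                  (fps_const (d - 1) * (fps_X ^ m * words_fps {1..m} (H_weight d m))))"

lemma H_fps_eq:
  fixes d :: "'a::idom"
  shows "(1 - fps_const d * fps_X) * H_fps N d =
         fps_const (d - 1) * ((1 - fps_X) * (\<Sum>m = 1..N. of_nat (totient m) * multiples_fps m))"
proof -
  have "(1 - fps_const d * fps_X) * H_fps N d =
      (\<Sum>m = 1..N. of_nat (totient m) * (fps_const (d - 1) *
        ((1 - fps_const d * fps_X) * (fps_X ^ m * words_fps {1..m} (H_weight d m)))))"
    unfolding H_fps_def sum_distrib_left by (simp only: mult_ac)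
  also have "\<dots> = (\<Sum>m = 1..N. of_nat (totient m) * (fps_const (d - 1) *
        ((1 - fps_X) * multiples_fps m)))"
    by (intro sum.cong refl arg_cong2[where f = times] words_fps_multiples_fps) simp
  finally show ?thesis
    unfolding sum_distrib_left by (simp only: mult_ac)
qed

lemma H_fps_nth:
  fixes d :: "'a::idom"
  assumes "n \<le> N"
  shows "H_fps N d $ n = d ^ n - 1"
  using assms
proof (induction n)
  case 0
  show ?case
    by (auto simp: H_fps_def fps_sum_nth fps_X_power_mult_nth fps_mult_nth
        fps_mult_left_const_nth intro!: sum.neutral)
next
  case (Suc n)
  let ?T = "\<Sum>m = 1..N. of_nat (totient m) * multiples_fps m :: 'a fps"
  have T: "?T $ k = of_nat k" if "k \<le> N" for k
    using sum_totient_multiples_fps[OF that]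
    by (simp add: fps_sum_nth fps_mult_left_const_nth flip: fps_of_nat)
  \<comment> \<open>Compare the coefficients of \<open>x\<^sup>n\<^sup>+\<^sup>1\<close> after clearing the denominator \<open>1 - d x\<close>.\<close>
  have "H_fps N d $ Suc n - d * H_fps N d $ n = (d - 1) * (?T $ Suc n - ?T $ n)"
    using arg_cong[OF H_fps_eq[of d N], of "\<lambda>f. f $ Suc n"]
    by (simp add: left_diff_distrib mult.assoc)
  also have "\<dots> = d - 1"
    unfolding T[OF Suc.prems] T[OF Suc_leD[OF Suc.prems]] by simp
  finally show ?case using Suc by (simp add: algebra_simps)
qed

section \<open>H-compositions as words behind their first part\<close>

lemma multiplicity_H_Cons: "multiplicity_H (m # Q) = count_list Q m"
proof -
  have "{j. 0 < j \<and> j < length (m # Q) \<and> (m # Q) ! j = (m # Q) ! 0} =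
      Suc ` {i. i < length Q \<and> Q ! i = m}"
    by (auto simp: image_iff gr0_conv_Suc)
  then have "multiplicity_H (m # Q) = card {i. i < length Q \<and> Q ! i = m}"
    by (simp add: multiplicity_H_def card_image)
  also have "\<dots> = count_list Q m"
    by (simp add: count_list_eq_length_filter length_filter_conv_card eq_commute)
  finally show ?thesis .
qed

lemma prod_list_H_weight:
  "prod_list (map (H_weight d m) Q) =
   (d - 1) ^ (length Q - count_list Q m) * d ^ count_list Q m"
proof (induction Q)
  case (Cons a Q)
  have "Suc (length Q) - count_list Q m = Suc (length Q - count_list Q m)"
    using count_le_length[of Q m] by simp
  with Cons show ?case by (simp add: H_weight_def mult_ac)
qed simp

lemma H_compositions_first_part:
  assumes "0 < n"
  shows "H_compositions n = (\<Union>m \<in> {1..n}. Cons m ` words {1..m} (n - m))"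
proof (rule set_eqI)
  fix P
  show "P \<in> H_compositions n \<longleftrightarrow> P \<in> (\<Union>m \<in> {1..n}. Cons m ` words {1..m} (n - m))"
  proof (cases P)
    case Nil
    with assms show ?thesis by (auto simp: H_compositions_def compositions_def)
  next
    case (Cons m Q)
    have "(\<forall>j < length P. P ! j \<le> P ! 0) \<longleftrightarrow> (\<forall>a \<in> set P. a \<le> m)"
      unfolding all_set_conv_all_nth Cons by simp
    moreover have "P \<in> (\<Union>m \<in> {1..n}. Cons m ` words {1..m} (n - m)) \<longleftrightarrow>
        1 \<le> m \<and> m \<le> n \<and> Q \<in> words {1..m} (n - m)"
      using Cons by auto
    ultimately show ?thesis
      using Cons by (auto simp: H_compositions_def compositions_def words_def Suc_le_eq)
  qed
qed

theorem theorem1p1: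
  fixes n d :: nat
  assumes "0 < n" and "0 < d"
  shows "(\<Sum>P \<in> H_compositions n.
           int (totient (P ! 0)) * (int d - 1) ^ (length P - multiplicity_H P) * int d ^ multiplicity_H P)
         = int d ^ n - 1"
proof -
  let ?f = "\<lambda>P. int (totient (P ! 0)) * (int d - 1) ^ (length P - multiplicity_H P)
                  * int d ^ multiplicity_H P"
  have f_Cons: "?f (m # Q) =
      int (totient m) * ((int d - 1) * prod_list (map (H_weight (int d) m) Q))" for m Q
    using count_le_length[of Q m]
    by (simp add: multiplicity_H_Cons prod_list_H_weight Suc_diff_le mult_ac)
  have "sum ?f (H_compositions n) =
      (\<Sum>m = 1..n. \<Sum>P \<in> Cons m ` words {1..m} (n - m). ?f P)"
    unfolding H_compositions_first_part[OF assms(1)]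
    by (intro sum.UNION_disjoint) (auto simp: finite_words)
  also have "\<dots> = (\<Sum>m = 1..n. int (totient m) *
      ((int d - 1) * words_fps {1..m} (H_weight (int d) m) $ (n - m)))"
  proof (intro sum.cong refl)
    fix m
    have "(\<Sum>P \<in> Cons m ` words {1..m} (n - m). ?f P) =
        (\<Sum>Q \<in> words {1..m} (n - m). ?f (m # Q))"
      by (subst sum.reindex) (auto simp: comp_def)
    then show "(\<Sum>P \<in> Cons m ` words {1..m} (n - m). ?f P) = int (totient m) *
      ((int d - 1) * words_fps {1..m} (H_weight (int d) m) $ (n - m))"
      unfolding f_Cons by (simp add: words_fps_def sum_distrib_left)
  qed
  also have "\<dots> = H_fps n (int d) $ n"
    unfolding H_fps_def fps_sum_nth
    by (intro sum.cong)
      (auto simp: fps_X_power_mult_nth fps_mult_left_const_nth simp flip: fps_of_nat)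
  also have "\<dots> = int d ^ n - 1"
    by (rule H_fps_nth) simp
  finally show ?thesis .
qed

end
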